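(* Let \[ U=\{(a,b)\in(\mathbb{Z}[i]\setminus\{0\})^2: ab\in\{1,\,2,\,3,\,\pm i,\, 1\pm i,\,2\pm i,\, 3\pm i,\,1\pm 2i,\, 2\pm 2i,\, 3\pm 2i\}\}\cup\{0\} \] and \[ U_1=\left\{\begin{aligned} &\{1,1\}, \{1,2\}, \{1,3\}, \{1,i\}, \{1,1+i\}, \{1,2+i\}, \{1,3+i\},\\ &\{1,1+2i\}, \{1,2+2i\}, \{1+i,1-i\}, \{1+i,2\}, \{1+i,2-i\} \end{aligned}\right\}. \] Then $\mathrm{Ex}(\overline{U_1})\subsetneq \mathrm{Ex}(U)$.
   Context: For a sequence of Gaussian integers $b_0,b_1,\dots$, $[b_0,b_1,\dots]$ denotes the (negative) Gaussian integer continued fraction $b_0-\cfrac{1}{b_1-\cfrac{1}{b_2-\cdots}}$; here it is regarded as the formal object determined by its coefficient sequence. A word is a nonempty finite sequence of Gaussian integers $(x_1,\dots,x_n)$; a word of length one is written $x_1$ (so $0$ denotes the one-letter word with entry $0$). A word $x$ is a substring of $[b_0,b_1,\dots]$ if $x=(b_r,b_{r+1},\dots,b_s)$ for some $0\leq r\leq s$ (contiguous). For a set $X$ of words and a unit $u\in\{\pm1,\pm i\}$, the operation $X\to X^u$ replaces each word $(x_1,x_2,\dots,x_n)$ of $X$ with $(ux_1,u^{-1}x_2,\dots,u^{(-1)^{n-1}}x_n)$. $\overline{X}$ is the smallest set of words in $\mathbb{Z}[i]$ that contains $X$ and the one-letter word $0$ and is closed under (entrywise) complex conjugation and under all operations $X\to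 X^u$, for every unit $u$. $X$ is symmetric if $X=\overline{X}$. For a symmetric set $X$, $\mathrm{Ex}(X)$ is the set of all infinite Gaussian integer continued fractions $[b_0,b_1,\dots]$ for which every tail $[b_n,b_{n+1},\dots]$ contains a substring from $X$. Sets of words closed under reversal are written as collections of multisets: the multiset $\{a,b\}$ stands for both words $(a,b)$ and $(b,a)$. *)

theory Defs
  imports Complex_Main "HOL-Library.Multiset"
begin

text \<open>Gaussian integers are rendered as a subset of the complex numbers, words as lists.\<close>

definition gauss_ints :: "complex set" where
  "gauss_ints = {z. Re z \<in> \<int> \<and> Im z \<in> \<int>}"

definition gauss_units :: "complex set" where
  "gauss_units = {1, -1, \<i>, -\<i>}"

definition words :: "complex list set" where
  "words = {w. w \<noteq> [] \<and> set w \<subseteq> gauss_ints}"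

text \<open>A continued fraction \<open>[b\<^sub>0, b\<^sub>1, \<dots>]\<close> is a formal object here, i.e. its coefficient sequence.\<close>

definition gauss_cfs :: "(nat \<Rightarrow> complex) set" where
  "gauss_cfs = {b. range b \<subseteq> gauss_ints}"

definition substring :: "complex list \<Rightarrow> (nat \<Rightarrow> complex) \<Rightarrow> bool" where
  "substring w b \<longleftrightarrow> (\<exists>r s. r \<le> s \<and> w = map b [r..<Suc s])"

text \<open>List indices start at 0, so the exponent of \<open>u\<close> at list index \<open>k\<close> is \<open>(-1)\<close> to the power \<open>k\<close>.\<close>

definition twist :: "complex \<Rightarrow> complex list \<Rightarrow> complex list" where
  "twist u w = map (\<lambda>k. u powi ((-1) ^ k) * w ! k) [0..<length w]"

inductive_set sym_closure :: "complex list set \<Rightarrow> complex list set"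
  for X :: "complex list set" where
  base: "w \<in> X \<Longrightarrow> w \<in> sym_closure X"
| zero: "[0] \<in> sym_closure X"
| conj: "w \<in> sym_closure X \<Longrightarrow> map cnj w \<in> sym_closure X"
| twist: "w \<in> sym_closure X \<Longrightarrow> u \<in> gauss_units \<Longrightarrow> twist u w \<in> sym_closure X"

definition symmetric :: "complex list set \<Rightarrow> bool" where
  "symmetric X \<longleftrightarrow> X = sym_closure X"

text \<open>Only meant for symmetric sets of words.\<close>

definition Ex_set :: "complex list set \<Rightarrow> (nat \<Rightarrow> complex) set" where
  "Ex_set X = {b \<in> gauss_cfs. \<forall>n. \<exists>w\<in>X. substring w (\<lambda>k. b (n + k))}"

definition words_of_multisets :: "complex multiset set \<Rightarrow> complex list set" where
  "words_of_multisets M = {w. mset w \<in> M}"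

definition U :: "complex list set" where
  "U = {[a, b] | a b. a \<in> gauss_ints - {0} \<and> b \<in> gauss_ints - {0} \<and>
          a * b \<in> {1, 2, 3, \<i>, -\<i>, 1 + \<i>, 1 - \<i>, 2 + \<i>, 2 - \<i>, 3 + \<i>, 3 - \<i>,
                   1 + 2 * \<i>, 1 - 2 * \<i>, 2 + 2 * \<i>, 2 - 2 * \<i>, 3 + 2 * \<i>, 3 - 2 * \<i>}}
       \<union> {[0]}"

definition U1 :: "complex list set" where
  "U1 = words_of_multisets
     {{#1, 1#}, {#1, 2#}, {#1, 3#}, {#1, \<i>#}, {#1, 1 + \<i>#}, {#1, 2 + \<i>#}, {#1, 3 + \<i>#},
      {#1, 1 + 2 * \<i>#}, {#1, 2 + 2 * \<i>#}, {#1 + \<i>, 1 - \<i>#}, {#1 + \<i>, 2#}, {#1 + \<i>, 2 - \<i>#}}"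

lemma gauss_ints_cnj: "z \<in> gauss_ints \<Longrightarrow> cnj z \<in> gauss_ints"
  by (simp add: gauss_ints_def)

lemma gauss_ints_mult: "x \<in> gauss_ints \<Longrightarrow> y \<in> gauss_ints \<Longrightarrow> x * y \<in> gauss_ints"
  by (simp add: gauss_ints_def)

lemma gauss_units_powi:
  assumes "u \<in> gauss_units"
  shows "u powi ((-1) ^ k) \<in> gauss_units"
proof (cases "even k")
  case True
  then show ?thesis using assms by simp
next
  case False
  then show ?thesis using assms by (auto simp: gauss_units_def power_int_minus)
qed

lemma sym_closure_words:
  assumes "X \<subseteq> words"
  shows "sym_closure X \<subseteq> words"
proof
  fix w assume "w \<in> sym_closure X"
  then show "w \<in> words"
  proof induction
    case (base w)
    then show ?case using assms by blast
  next
    case zero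
    then show ?case by (simp add: words_def gauss_ints_def)
  next
    case (conj w)
    then show ?case by (auto simp: words_def intro: gauss_ints_cnj)
  next
    case (twist w u)
    have "gauss_units \<subseteq> gauss_ints" by (auto simp: gauss_units_def gauss_ints_def)
    then have "u powi ((-1) ^ k) * w ! k \<in> gauss_ints" if "k < length w" for k
      using twist that gauss_units_powi[OF twist.hyps(2)] nth_mem[OF that]
      by (intro gauss_ints_mult) (auto simp: words_def)
    then show ?case using twist.IH by (auto simp: words_def twist_def)
  qed
qed

lemma symmetric_sym_closure: "symmetric (sym_closure X)"
proof -
  have "w \<in> sym_closure X" if "w \<in> sym_closure (sym_closure X)" for w
    using that by induction (auto intro: sym_closure.intros)
  then show ?thesis unfolding symmetric_def by (auto intro: sym_closure.base)
qed

lemma U_words: "U \<subseteq> words"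
  by (auto simp: U_def words_def gauss_ints_def)

lemma U1_words: "U1 \<subseteq> words"
  by (auto simp: U1_def words_of_multisets_def words_def gauss_ints_def simp flip: set_mset_mset)

lemma symmetric_U: "symmetric U"
proof -
  have "w \<in> U" if "w \<in> sym_closure U" for w
    using that
  proof induction
    case (conj w)
    then consider "w = [0]" | a b where "w = [a, b]" "[a, b] \<in> U"
      by (auto simp: U_def)
    then show ?case
    proof cases
      case 1
      then show ?thesis by (simp add: U_def)
    next
      case 2
      have "cnj a * cnj b = cnj (a * b)" "cnj (2 * \<i>) = - (2 * \<i>)" by simp_all
      with 2 show ?thesis
        by (auto simp: U_def gauss_ints_cnj simp del: complex_cnj_mult)
    qed
  next
    case (twist w u)
    from twist.hyps have u: "u \<noteq> 0" "u \<in> gauss_ints" "inverse u \<in> gauss_ints"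
      by (auto simp: gauss_units_def gauss_ints_def)
    from twist.IH consider "w = [0]" | a b where "w = [a, b]" "[a, b] \<in> U"
      by (auto simp: U_def)
    then show ?case
    proof cases
      case 1
      then show ?thesis by (simp add: U_def twist_def)
    next
      case 2
      have "twist u w = [u * a, inverse u * b]"
        using 2 by (simp add: twist_def power_int_minus)
      moreover have eq: "u * a * (inverse u * b) = a * b" using u by simp
      ultimately show ?thesis
        using 2 u by (simp add: U_def gauss_ints_mult eq)
    qed
  qed (auto simp: U_def)
  then show ?thesis unfolding symmetric_def by (auto intro: sym_closure.base)
qed

end

theory Submission
  imports Defs
begin

text \<open>The product \<open>ab\<close> of a two-letter word is invariant under the twists and is conjugated by
  conjugation. The words of \<open>U1\<close> have products occurring in \<open>U\<close>, but never \<open>3 \<plusminus> 2\<i>\<close>, so the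
  periodic continued fraction \<open>[1, 3 + 2\<i>, 1, 3 + 2\<i>, \<dots>]\<close> separates the two sets.\<close>

lemma mset_eq_doubleton_iff: "mset w = {#x, y#} \<longleftrightarrow> w = [x, y] \<or> w = [y, x]"
proof
  assume eq: "mset w = {#x, y#}"
  then have "length w = 2"
    by (metis size_mset size_add_mset size_empty numeral_2_eq_2)
  then obtain a b where "w = [a, b]"
    by (auto simp: length_Suc_conv numeral_2_eq_2)
  with eq show "w = [x, y] \<or> w = [y, x]"
    by (auto simp: add_eq_conv_ex)
qed auto

lemma twist_pair: "twist u [a, b] = [u * a, inverse u * b]"
  by (simp add: twist_def power_int_minus)

text \<open>From here on, only the product of the two entries of a word in \<open>U1\<close>
  matters. A pair with an entry \<open>1\<close> has the other entry as its product; the three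
  remaining multisets give \<open>2\<close>, \<open>2 + 2 * \<i>\<close> and
  \<open>3 + \<i>\<close>, so nine values suffice.\<close>

lemma U1_wordE:
  assumes "w \<in> U1"
  obtains a b where "w = [a, b]" "a \<in> gauss_ints - {0}" "b \<in> gauss_ints - {0}"
    "a * b \<in> {1, 2, 3, \<i>, 1 + \<i>, 2 + \<i>, 3 + \<i>, 1 + 2 * \<i>, 2 + 2 * \<i>}"
proof -
  \<comment> \<open>Phrased with \<open>length\<close> and \<open>!\<close> rather than
    existentially, so that each concrete word is settled by evaluation.\<close>
  have "length w = 2 \<and> set w \<subseteq> gauss_ints - {0} \<and>
    w ! 0 * w ! 1 \<in> {1, 2, 3, \<i>, 1 + \<i>, 2 + \<i>, 3 + \<i>, 1 + 2 * \<i>, 2 + 2 * \<i>}"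
    using assms
    unfolding U1_def words_of_multisets_def mem_Collect_eq insert_iff empty_iff mset_eq_doubleton_iff
    by (elim disjE FalseE; simp add: gauss_ints_def complex_eq_iff)
  then obtain a b where "w = [a, b]" "set w \<subseteq> gauss_ints - {0}"
    "w ! 0 * w ! 1 \<in> {1, 2, 3, \<i>, 1 + \<i>, 2 + \<i>, 3 + \<i>, 1 + 2 * \<i>, 2 + 2 * \<i>}"
    by (auto simp: length_Suc_conv numeral_2_eq_2)
  then show thesis by (intro that) simp_all
qed

lemma U1_subset_U: "U1 \<subseteq> U"
proof
  fix w assume "w \<in> U1"
  then obtain a b where "w = [a, b]" "a \<in> gauss_ints - {0}" "b \<in> gauss_ints - {0}"
    "a * b \<in> {1, 2, 3, \<i>, 1 + \<i>, 2 + \<i>, 3 + \<i>, 1 + 2 * \<i>, 2 + 2 * \<i>}"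
    by (rule U1_wordE)
  then show "w \<in> U" unfolding U_def by blast
qed

lemma sym_closure_mono: "X \<subseteq> Y \<Longrightarrow> sym_closure X \<subseteq> sym_closure Y"
proof
  fix w assume "X \<subseteq> Y" "w \<in> sym_closure X"
  from this(2,1) show "w \<in> sym_closure Y"
    by induction (auto intro: sym_closure.intros)
qed

text \<open>The excluded pair of products is stable under conjugation, which lets the invariant pass
  through \<open>conj\<close>; in a twist, \<open>u\<close> and \<open>inverse u\<close>
  cancel.\<close>

lemma sym_closure_U1_product:
  assumes "w \<in> sym_closure U1"
  shows "w = [0] \<or> (\<exists>a b. w = [a, b] \<and> a * b \<notin> {3 + 2 * \<i>, 3 - 2 * \<i>})"
  using assms
proof induction
  case (base w)
  then obtain a b where ab: "w = [a, b]"
    "a * b \<in> {1, 2, 3, \<i>, 1 + \<i>, 2 + \<i>, 3 + \<i>, 1 + 2 * \<i>, 2 + 2 * \<i>}"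
    by (rule U1_wordE)
  from ab(2) have "a * b \<notin> {3 + 2 * \<i>, 3 - 2 * \<i>}"
    unfolding insert_iff empty_iff by (elim disjE FalseE; simp only: complex_eq_iff; simp)
  with ab(1) show ?case by blast
next
  case (conj w)
  have "cnj a * cnj b \<notin> {3 + 2 * \<i>, 3 - 2 * \<i>}"
    if "a * b \<notin> {3 + 2 * \<i>, 3 - 2 * \<i>}" for a b
    using that by (auto simp: complex_eq_iff)
  with conj.IH show ?case by auto
next
  case (twist w u)
  have eq: "u * a * (inverse u * b) = a * b" for a b
    using twist.hyps by (auto simp: gauss_units_def)
  from twist.IH show ?case
  proof (elim disjE exE conjE)
    assume "w = [0]"
    then show ?thesis by (simp add: twist_def)
  next
    fix a b assume "w = [a, b]" "a * b \<notin> {3 + 2 * \<i>, 3 - 2 * \<i>}"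
    then have "twist u w = [u * a, inverse u * b]"
      "u * a * (inverse u * b) \<notin> {3 + 2 * \<i>, 3 - 2 * \<i>}"
      by (simp_all only: twist_pair eq not_False_eq_True)
    then show ?thesis by blast
  qed
qed (rule disjI1, rule refl)

lemma Ex_set_mono: "X \<subseteq> Y \<Longrightarrow> Ex_set X \<subseteq> Ex_set Y"
  unfolding Ex_set_def by (rule Collect_mono) (meson subsetD)

lemma substring_singleton_iff: "substring [x] b \<longleftrightarrow> (\<exists>r. b r = x)"
proof
  assume "substring [x] b"
  then obtain r s where rs: "r \<le> s" "[x] = map b [r..<Suc s]"
    unfolding substring_def by (elim exE conjE)
  \<comment> \<open>Comparing lengths determines the interval: \<open>[r..<Suc s]\<close> must have
    one element.\<close>
  from arg_cong[OF rs(2), of length] rs(1) have "s = r" by simp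
  with rs(2) have "b r = x" by simp
  then show "\<exists>r. b r = x" ..
next
  assume "\<exists>r. b r = x"
  then obtain r where "b r = x" ..
  then show "substring [x] b"
    unfolding substring_def by (intro exI[of _ r]) simp
qed

lemma substring_pair_iff: "substring [x, y] b \<longleftrightarrow> (\<exists>r. b r = x \<and> b (Suc r) = y)"
proof
  assume "substring [x, y] b"
  then obtain r s where rs: "r \<le> s" "[x, y] = map b [r..<Suc s]"
    unfolding substring_def by (elim exE conjE)
  from arg_cong[OF rs(2), of length] rs(1) have "s = Suc r" by simp
  with rs(2) have "b r = x \<and> b (Suc r) = y" by simp
  then show "\<exists>r. b r = x \<and> b (Suc r) = y" ..
next
  assume "\<exists>r. b r = x \<and> b (Suc r) = y"
  then obtain r where "b r = x" "b (Suc r) = y" by blast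
  then show "substring [x, y] b"
    unfolding substring_def by (intro exI[of _ r] exI[of _ "Suc r"]) simp
qed

theorem corollaryE: "Ex_set (sym_closure U1) \<subset> Ex_set U"
proof
  \<comment> \<open>Since \<open>U\<close> is its own closure, monotonicity of the closure is
    enough.\<close>
  have "sym_closure U1 \<subseteq> U"
    using sym_closure_mono[OF U1_subset_U] symmetric_U by (simp add: symmetric_def)
  then show "Ex_set (sym_closure U1) \<subseteq> Ex_set U"
    by (rule Ex_set_mono)
next
  define b :: "nat \<Rightarrow> complex" where "b = (\<lambda>n. if even n then 1 else 3 + 2 * \<i>)"
  \<comment> \<open>The product is the same for both parities of \<open>n\<close>, so every adjacent
    pair lies in \<open>U\<close>.\<close>
  have b_prod: "b n * b (Suc n) = 3 + 2 * \<i>" for n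
    by (simp add: b_def)
  have b_ne: "b n \<noteq> 0" for n
    by (simp add: b_def complex_eq_iff)
  have b_int: "b n \<in> gauss_ints" for n
    by (simp add: b_def gauss_ints_def)
  have "[b n, b (Suc n)] \<in> U" for n
    using b_ne b_int b_prod by (simp add: U_def)
  \<comment> \<open>The pair stands at the very start of the tail, hence offset
    \<open>0\<close>.\<close>
  moreover have "substring [b n, b (Suc n)] (\<lambda>k. b (n + k))" for n
    unfolding substring_pair_iff by (intro exI[of _ 0]) simp
  ultimately have in_U: "b \<in> Ex_set U"
    using b_int by (auto simp: Ex_set_def gauss_cfs_def)
  have "b \<notin> Ex_set (sym_closure U1)"
  proof
    assume "b \<in> Ex_set (sym_closure U1)"
    \<comment> \<open>The tail at \<open>0\<close> suffices: \<open>b\<close> contains no word of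
      the closure at all. Nonzero entries exclude \<open>[0]\<close>, and the constant product
      excludes the two-letter words.\<close>
    then obtain w where "w \<in> sym_closure U1" and sub: "substring w (\<lambda>k. b (0 + k))"
      unfolding Ex_set_def by blast
    from sym_closure_U1_product[OF this(1)] show False
      using sub b_ne b_prod by (auto simp: substring_singleton_iff substring_pair_iff)
  qed
  with in_U show "Ex_set (sym_closure U1) \<noteq> Ex_set U" by blast
qed

end
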